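(* For an (extended) metric space $(X,d)$, the following are equivalent: (1) $(X,d)$ is coarsely geodesic; (2) there exists a $\prec$-maximal metric within the coarse equivalence class of $d$ (i.e. a $\prec$-maximal element among metrics on $X$ coarsely equivalent to $d$); (3) there exists a $\prec$-minimal element among quasigeodesic metrics $d'$ on $X$ with $d\prec d'$. Moreover, when such extremal metrics exist, any quasigeodesic metric $d'$ on $X$ coarsely equivalent to $d$ realises both the maximal property in (2) and the minimal property in (3).
   Context: Metrics are extended: distances may be $\infty$. Maps $f,f'\colon X\to Y$ are close if $\sup_{x} d_Y(fx,f'x)<\infty$. An upper control for $f\colon X\to Y$ is a proper (non-strictly) increasing $\rho\colon[0,\infty)\to[0,\infty)$ with $d_Y(fx,fx')\le\rho(d_X(x,x'))$ whenever $d_X(x,x')<\infty$; $f$ is controlled if it has an upper control and coarsely Lipschitz if it has an affine one. A coarse equivalence is a controlled map having a controlled inverse up to closeness; a quasi-isometry is a coarsely Lipschitz map having a coarsely Lipschitz inverse up to closeness. A metric space is coarsely geodesic (resp. quasigeodesic) if it is coarsely equivalent (resp. quasi-isometric) to a graph with its combinatorial metric (graphs may be disconnected, with points in different components at distance $\infty$). A metric $d'$ on $X$ is called quasigeodesic if $(X,d')$ is; two metrics on $X$ are coarsely equivalent if the underlying identity between them is a coarse equivalence. For metrics $d_1,d_2$ on a set $X$, write $d_1\prec d_2$ if the underlying identity $(X,d_2)\to(X,d_1)$ is coarsely Lipschitz; this is a preorder. An element $m$ of a set $M$ of metrics is $\prec$-maximal (resp. $\prec$-minimal) in $M$ if $m'\in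 M$ and $m\prec m'$ (resp. $m'\prec m$) imply $m'\prec m$ (resp. $m\prec m'$). *)

theory Defs
  imports "HOL-Analysis.Analysis"
begin

text \<open>
  A space is a carrier set together with a distance function on the ambient type; only the values
  of the distance on the carrier matter. The carrier may be empty.
\<close>

definition ext_metric :: "'a set \<Rightarrow> ('a \<Rightarrow> 'a \<Rightarrow> ennreal) \<Rightarrow> bool" where
  "ext_metric X d \<longleftrightarrow>
     (\<forall>x\<in>X. \<forall>y\<in>X. d x y = 0 \<longleftrightarrow> x = y) \<and>
     (\<forall>x\<in>X. \<forall>y\<in>X. d x y = d y x) \<and>
     (\<forall>x\<in>X. \<forall>y\<in>X. \<forall>z\<in>X. d x z \<le> d x y + d y z)"

definition close :: "'a set \<Rightarrow> ('b \<Rightarrow> 'b \<Rightarrow> ennreal) \<Rightarrow> ('a \<Rightarrow> 'b) \<Rightarrow> ('a \<Rightarrow> 'b) \<Rightarrow> bool" where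
  "close X dY f f' \<longleftrightarrow> (SUP x\<in>X. dY (f x) (f' x)) < \<infinity>"

text \<open>
  Controls are real functions of which only the values on \<open>[0,\<infinity>)\<close> matter. They need not be
  continuous, so properness is meant metrically: preimages of bounded sets are bounded.
\<close>

definition control_function :: "(real \<Rightarrow> real) \<Rightarrow> bool" where
  "control_function \<rho> \<longleftrightarrow>
     \<rho> ` {0..} \<subseteq> {0..} \<and> mono_on {0..} \<rho> \<and>
     (\<forall>B. bounded B \<longrightarrow> bounded ({0..} \<inter> \<rho> -` B))"

definition upper_control ::
  "'a set \<Rightarrow> ('a \<Rightarrow> 'a \<Rightarrow> ennreal) \<Rightarrow> ('b \<Rightarrow> 'b \<Rightarrow> ennreal) \<Rightarrow> ('a \<Rightarrow> 'b) \<Rightarrow> (real \<Rightarrow> real) \<Rightarrow> bool" where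
  "upper_control X dX dY f \<rho> \<longleftrightarrow>
     control_function \<rho> \<and>
     (\<forall>x\<in>X. \<forall>x'\<in>X. dX x x' < \<infinity> \<longrightarrow> dY (f x) (f x') \<le> ennreal (\<rho> (enn2real (dX x x'))))"

definition controlled ::
  "'a set \<Rightarrow> ('a \<Rightarrow> 'a \<Rightarrow> ennreal) \<Rightarrow> 'b set \<Rightarrow> ('b \<Rightarrow> 'b \<Rightarrow> ennreal) \<Rightarrow> ('a \<Rightarrow> 'b) \<Rightarrow> bool" where
  "controlled X dX Y dY f \<longleftrightarrow> f ` X \<subseteq> Y \<and> (\<exists>\<rho>. upper_control X dX dY f \<rho>)"

definition coarsely_Lipschitz ::
  "'a set \<Rightarrow> ('a \<Rightarrow> 'a \<Rightarrow> ennreal) \<Rightarrow> 'b set \<Rightarrow> ('b \<Rightarrow> 'b \<Rightarrow> ennreal) \<Rightarrow> ('a \<Rightarrow> 'b) \<Rightarrow> bool" where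
  "coarsely_Lipschitz X dX Y dY f \<longleftrightarrow>
     f ` X \<subseteq> Y \<and> (\<exists>a b. upper_control X dX dY f (\<lambda>t. a * t + b))"

definition coarse_equivalence ::
  "'a set \<Rightarrow> ('a \<Rightarrow> 'a \<Rightarrow> ennreal) \<Rightarrow> 'b set \<Rightarrow> ('b \<Rightarrow> 'b \<Rightarrow> ennreal) \<Rightarrow> ('a \<Rightarrow> 'b) \<Rightarrow> bool" where
  "coarse_equivalence X dX Y dY f \<longleftrightarrow>
     controlled X dX Y dY f \<and>
     (\<exists>g. controlled Y dY X dX g \<and> close X dX (g \<circ> f) id \<and> close Y dY (f \<circ> g) id)"

definition quasi_isometry ::
  "'a set \<Rightarrow> ('a \<Rightarrow> 'a \<Rightarrow> ennreal) \<Rightarrow> 'b set \<Rightarrow> ('b \<Rightarrow> 'b \<Rightarrow> ennreal) \<Rightarrow> ('a \<Rightarrow> 'b) \<Rightarrow> bool" where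
  "quasi_isometry X dX Y dY f \<longleftrightarrow>
     coarsely_Lipschitz X dX Y dY f \<and>
     (\<exists>g. coarsely_Lipschitz Y dY X dX g \<and> close X dX (g \<circ> f) id \<and> close Y dY (f \<circ> g) id)"

definition simple_graph :: "'v set \<Rightarrow> ('v \<times> 'v) set \<Rightarrow> bool" where
  "simple_graph V E \<longleftrightarrow> E \<subseteq> V \<times> V \<and> sym E \<and> irrefl E"

text \<open>
  The pairs in \<open>E ^^ n\<close> are those joined by a walk with \<open>n\<close> edges; the infimum is \<open>\<infinity>\<close> when there
  is no walk.
\<close>

definition graph_dist :: "('v \<times> 'v) set \<Rightarrow> 'v \<Rightarrow> 'v \<Rightarrow> ennreal" where
  "graph_dist E u v = (INF n\<in>{n. (u, v) \<in> E ^^ n}. of_nat n)"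

text \<open>
  HOL cannot quantify over types inside a formula, so the type from which the vertices of the
  graph are taken is an explicit argument.
\<close>

definition coarsely_geodesic :: "'v itself \<Rightarrow> 'a set \<Rightarrow> ('a \<Rightarrow> 'a \<Rightarrow> ennreal) \<Rightarrow> bool" where
  "coarsely_geodesic _ X d \<longleftrightarrow>
     (\<exists>(V :: 'v set) E f. simple_graph V E \<and> coarse_equivalence X d V (graph_dist E) f)"

definition quasigeodesic :: "'v itself \<Rightarrow> 'a set \<Rightarrow> ('a \<Rightarrow> 'a \<Rightarrow> ennreal) \<Rightarrow> bool" where
  "quasigeodesic _ X d \<longleftrightarrow>
     (\<exists>(V :: 'v set) E f. simple_graph V E \<and> quasi_isometry X d V (graph_dist E) f)"

definition coarsely_equivalent_metrics ::
  "'a set \<Rightarrow> ('a \<Rightarrow> 'a \<Rightarrow> ennreal) \<Rightarrow> ('a \<Rightarrow> 'a \<Rightarrow> ennreal) \<Rightarrow> bool" where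
  "coarsely_equivalent_metrics X d d' \<longleftrightarrow> coarse_equivalence X d X d' id"

text \<open>Note the direction: \<open>prec X d1 d2\<close> concerns the identity from \<open>(X, d2)\<close> to \<open>(X, d1)\<close>.\<close>

definition prec :: "'a set \<Rightarrow> ('a \<Rightarrow> 'a \<Rightarrow> ennreal) \<Rightarrow> ('a \<Rightarrow> 'a \<Rightarrow> ennreal) \<Rightarrow> bool" where
  "prec X d1 d2 \<longleftrightarrow> coarsely_Lipschitz X d2 X d1 id"

definition prec_maximal ::
  "'a set \<Rightarrow> ('a \<Rightarrow> 'a \<Rightarrow> ennreal) set \<Rightarrow> ('a \<Rightarrow> 'a \<Rightarrow> ennreal) \<Rightarrow> bool" where
  "prec_maximal X M m \<longleftrightarrow> m \<in> M \<and> (\<forall>m'\<in>M. prec X m m' \<longrightarrow> prec X m' m)"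

definition prec_minimal ::
  "'a set \<Rightarrow> ('a \<Rightarrow> 'a \<Rightarrow> ennreal) set \<Rightarrow> ('a \<Rightarrow> 'a \<Rightarrow> ennreal) \<Rightarrow> bool" where
  "prec_minimal X M m \<longleftrightarrow> m \<in> M \<and> (\<forall>m'\<in>M. prec X m' m \<longrightarrow> prec X m m')"

definition coarse_class :: "'a set \<Rightarrow> ('a \<Rightarrow> 'a \<Rightarrow> ennreal) \<Rightarrow> ('a \<Rightarrow> 'a \<Rightarrow> ennreal) set" where
  "coarse_class X d = {d'. ext_metric X d' \<and> coarsely_equivalent_metrics X d d'}"

definition quasigeodesic_above ::
  "'v itself \<Rightarrow> 'a set \<Rightarrow> ('a \<Rightarrow> 'a \<Rightarrow> ennreal) \<Rightarrow> ('a \<Rightarrow> 'a \<Rightarrow> ennreal) set" where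
  "quasigeodesic_above T X d = {d'. ext_metric X d' \<and> quasigeodesic T X d' \<and> prec X d d'}"

text \<open>
  Over the vertex type \<open>'a + 'v\<close>, with \<open>'a\<close> the point type of the space and \<open>'v\<close> an arbitrary type
  variable, no graph is excluded: a graph with vertices in any type \<open>'v\<close> can be relabelled along
  \<open>Inr\<close>. The summand \<open>'a\<close> ensures that the graphs on the point set itself are always available;
  over a type too small for that (such as \<open>unit\<close>) the existence of a graph would fail for reasons
  of cardinality only.
\<close>

end

theory Submission
  imports Defs
begin

text \<open>
  For a natural number \<open>n\<close> let \<open>G n\<close> be the graph on \<open>X\<close> whose edges are the pairs at
  \<open>d\<close>-distance at most \<open>n\<close>. Its distance always lies above \<open>d\<close>, and pulling walks back from a graph
  coarsely equivalent (quasi-isometric) to \<open>(X, d)\<close> shows that for large \<open>n\<close> it is coarsely equivalent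
  to \<open>d\<close> (respectively lies below \<open>d\<close>). Since a map out of a graph is Lipschitz once it is bounded on
  edges, every metric controlled by a quasigeodesic metric lies below it, which yields the
  extremality of quasigeodesic metrics. Conversely, a maximal metric \<open>m\<close> must dominate one of its own
  graph distances, as otherwise a supremum of truncated graph distances would be strictly above it;
  and a minimal metric lies below the distance of \<open>G n\<close> for all large \<open>n\<close>, so it is bounded on all
  pairs of bounded \<open>d\<close>-distance.
\<close>

section \<open>Integer criteria for closeness, control and coarse Lipschitz maps\<close>

lemma close_iff:
  "close X d f f' \<longleftrightarrow> (\<exists>N::nat. \<forall>x\<in>X. d (f x) (f' x) \<le> of_nat N)"
proof
  assume "close X d f f'"
  then have "(SUP x\<in>X. d (f x) (f' x)) < top" by (simp add: close_def)
  then obtain N :: nat where "(SUP x\<in>X. d (f x) (f' x)) \<le> of_nat N"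
    using ennreal_Ex_less_of_nat[of "SUP x\<in>X. d (f x) (f' x)"] by (auto intro: less_imp_le)
  then show "\<exists>N::nat. \<forall>x\<in>X. d (f x) (f' x) \<le> of_nat N"
    by (auto simp: SUP_le_iff)
next
  assume "\<exists>N::nat. \<forall>x\<in>X. d (f x) (f' x) \<le> of_nat N"
  then obtain N :: nat where "(SUP x\<in>X. d (f x) (f' x)) \<le> of_nat N"
    by (auto simp: SUP_le_iff)
  also have "of_nat N < (top :: ennreal)" by (rule of_nat_less_top)
  finally show "close X d f f'" by (simp add: close_def)
qed

text \<open>A linear lower bound with positive slope forces properness; the controls constructed
  below are shown to be proper in this way.\<close>

lemma bounded_preimage_if_ge:
  fixes \<rho> :: "real \<Rightarrow> real"
  assumes "c > 0" "\<And>t. t \<ge> 0 \<Longrightarrow> c * t \<le> \<rho> t" "bounded B"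
  shows "bounded ({0..} \<inter> \<rho> -` B)"
proof -
  obtain M where M: "\<And>s. s \<in> B \<Longrightarrow> \<bar>s\<bar> \<le> M"
    using \<open>bounded B\<close> by (auto simp: bounded_iff)
  have "t \<le> M / c" if "t \<ge> 0" "\<rho> t \<in> B" for t
  proof -
    have "c * t \<le> M" using assms(2)[OF that(1)] M[OF that(2)] by linarith
    then show ?thesis using \<open>c > 0\<close> by (simp add: field_simps)
  qed
  then have "{0..} \<inter> \<rho> -` B \<subseteq> {0..M / c}" by auto
  then show ?thesis using bounded_closed_interval bounded_subset by blast
qed

text \<open>Replaces controls by one integer bound for each integer radius, the form in which
  control is used from here on. A control yields such bounds by monotonicity; conversely, arbitrary
  bounds can be assembled into a proper increasing function.\<close>

lemma controlled_iff:
  "controlled X dX Y dY f \<longleftrightarrow>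
     f ` X \<subseteq> Y \<and>
     (\<forall>n::nat. \<exists>N::nat. \<forall>x\<in>X. \<forall>y\<in>X. dX x y \<le> of_nat n \<longrightarrow> dY (f x) (f y) \<le> of_nat N)"
    (is "_ \<longleftrightarrow> _ \<and> ?bdd")
proof
  assume c: "controlled X dX Y dY f"
  then obtain \<rho> where \<rho>: "upper_control X dX dY f \<rho>" by (auto simp: controlled_def)
  have "\<exists>N::nat. \<forall>x\<in>X. \<forall>y\<in>X. dX x y \<le> of_nat n \<longrightarrow> dY (f x) (f y) \<le> of_nat N" for n :: nat
  proof -
    obtain N :: nat where N: "\<rho> (real n) \<le> real N" using real_arch_simple by blast
    have "dY (f x) (f y) \<le> of_nat N" if "x \<in> X" "y \<in> X" "dX x y \<le> of_nat n" for x y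
    proof -
      have fin: "dX x y < \<infinity>"
        using that(3) by (metis infinity_ennreal_def of_nat_less_top order_le_less_trans)
      have "enn2real (dX x y) \<le> real n"
        using that(3) enn2real_mono[of "dX x y" "of_nat n"] by (simp add: of_nat_less_top)
      then have "\<rho> (enn2real (dX x y)) \<le> \<rho> (real n)"
        using \<rho> by (auto simp: upper_control_def control_function_def intro: mono_onD)
      then have le: "\<rho> (enn2real (dX x y)) \<le> real N" using N by linarith
      have "dY (f x) (f y) \<le> ennreal (\<rho> (enn2real (dX x y)))"
        using \<rho> fin that by (auto simp: upper_control_def)
      also have "\<dots> \<le> ennreal (real N)" by (rule ennreal_leI[OF le])
      finally show ?thesis by (simp add: ennreal_of_nat_eq_real_of_nat)
    qed
    then show ?thesis by blast
  qed
  then show "f ` X \<subseteq> Y \<and> ?bdd" using c by (auto simp: controlled_def)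
next
  assume R: "f ` X \<subseteq> Y \<and> ?bdd"
  then obtain N :: "nat \<Rightarrow> nat" where N:
    "\<And>n x y. x \<in> X \<Longrightarrow> y \<in> X \<Longrightarrow> dX x y \<le> of_nat n \<Longrightarrow> dY (f x) (f y) \<le> of_nat (N n)"
    by metis
  \<comment> \<open>Summing the bounds makes them monotone in the radius, and the summand
    \<open>t\<close> makes the function proper even if the bounds stay constant.\<close>
  define \<rho> where "\<rho> t = t + real (\<Sum>k\<le>nat \<lceil>t\<rceil>. N k)" for t :: real
  have "mono_on {0..} \<rho>"
  proof (rule mono_onI)
    fix s t :: real assume "s \<le> t"
    then have "nat \<lceil>s\<rceil> \<le> nat \<lceil>t\<rceil>" by (intro nat_mono ceiling_mono)
    then have "(\<Sum>k\<le>nat \<lceil>s\<rceil>. N k) \<le> (\<Sum>k\<le>nat \<lceil>t\<rceil>. N k)"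
      by (intro sum_mono2) auto
    then show "\<rho> s \<le> \<rho> t" unfolding \<rho>_def using \<open>s \<le> t\<close> by (meson add_mono of_nat_mono)
  qed
  moreover have "bounded ({0..} \<inter> \<rho> -` B)" if "bounded B" for B
    by (rule bounded_preimage_if_ge[of 1]) (use that in \<open>auto simp: \<rho>_def intro!: sum_nonneg\<close>)
  moreover have "\<rho> ` {0..} \<subseteq> {0..}" by (auto simp: \<rho>_def intro!: add_nonneg_nonneg sum_nonneg)
  moreover have "dY (f x) (f y) \<le> ennreal (\<rho> (enn2real (dX x y)))"
    if "x \<in> X" "y \<in> X" "dX x y < \<infinity>" for x y
  proof -
    define t where "t = enn2real (dX x y)"
    have t: "t \<ge> 0" "dX x y = ennreal t" using that(3) by (auto simp: t_def)
    define n where "n = nat \<lceil>t\<rceil>"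
    have "t \<le> real n" using t(1) by (simp add: n_def)
    then have "dX x y \<le> of_nat n" by (simp add: t(2) ennreal_of_nat_eq_real_of_nat ennreal_leI)
    then have "dY (f x) (f y) \<le> of_nat (N n)" using N that by blast
    also have "\<dots> = ennreal (real (N n))" by (simp add: ennreal_of_nat_eq_real_of_nat)
    also have "N n \<le> (\<Sum>k\<le>n. N k)" by (rule member_le_sum) auto
    then have "real (N n) \<le> \<rho> t"
      unfolding \<rho>_def n_def[symmetric] using t(1) by (meson add_increasing of_nat_mono)
    then have "ennreal (real (N n)) \<le> ennreal (\<rho> t)" by (rule ennreal_leI)
    finally show ?thesis by (simp add: t_def)
  qed
  ultimately have "upper_control X dX dY f \<rho>"
    by (simp add: upper_control_def control_function_def)
  then show "controlled X dX Y dY f" using R by (auto simp: controlled_def)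
qed

text \<open>Merging slope and offset into one natural number gives a bound in \<open>ennreal\<close>
  that also makes sense at infinite distances, so that later estimates need no case
  distinction.\<close>

lemma coarsely_Lipschitz_iff:
  "coarsely_Lipschitz X dX Y dY f \<longleftrightarrow>
     f ` X \<subseteq> Y \<and> (\<exists>N::nat. \<forall>x\<in>X. \<forall>y\<in>X. dY (f x) (f y) \<le> of_nat N * (dX x y + 1))"
    (is "_ \<longleftrightarrow> _ \<and> ?lip")
proof
  assume c: "coarsely_Lipschitz X dX Y dY f"
  then obtain a b where ab: "upper_control X dX dY f (\<lambda>t. a * t + b)"
    by (auto simp: coarsely_Lipschitz_def)
  \<comment> \<open>The lower bound \<open>1\<close> keeps \<open>N\<close> positive, so that the
    right-hand side is \<open>top\<close> when \<open>dX x y\<close> is infinite.\<close>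
  obtain N :: nat where N: "max (max a b) 1 \<le> real N" using real_arch_simple by blast
  have "dY (f x) (f y) \<le> of_nat N * (dX x y + 1)" if xy: "x \<in> X" "y \<in> X" for x y
  proof (cases "dX x y < \<infinity>")
    case True
    define t where "t = enn2real (dX x y)"
    have t: "t \<ge> 0" "dX x y = ennreal t" using True by (auto simp: t_def)
    have "dY (f x) (f y) \<le> ennreal (a * t + b)"
      using ab True xy by (auto simp: upper_control_def t_def)
    also have "a * t + b \<le> real N * (t + 1)"
      using N t(1) mult_right_mono[of a "real N" t] by (simp add: algebra_simps)
    then have "ennreal (a * t + b) \<le> ennreal (real N * (t + 1))" by (rule ennreal_leI)
    also have "\<dots> = of_nat N * (dX x y + 1)"
      using t(1) by (simp add: t(2) ennreal_mult ennreal_of_nat_eq_real_of_nat flip: ennreal_plus ennreal_1)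
    finally show ?thesis .
  next
    case False
    then have "dX x y = top" by (simp add: less_top[symmetric])
    moreover have "of_nat N \<noteq> (0::ennreal)" using N by auto
    ultimately show ?thesis by (simp add: ennreal_mult_top)
  qed
  then show "f ` X \<subseteq> Y \<and> ?lip" using c by (auto simp: coarsely_Lipschitz_def)
next
  assume R: "f ` X \<subseteq> Y \<and> ?lip"
  then obtain N :: nat where N:
    "\<And>x y. x \<in> X \<Longrightarrow> y \<in> X \<Longrightarrow> dY (f x) (f y) \<le> of_nat N * (dX x y + 1)" by blast
  \<comment> \<open>The slope is raised to \<open>N + 1\<close> so that it is positive, hence the
    control proper, also for \<open>N = 0\<close>.\<close>
  define \<rho> where "\<rho> t = (real N + 1) * t + real N" for t :: real
  have "mono_on {0..} \<rho>"
    by (auto simp: \<rho>_def intro!: mono_onI mult_left_mono)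
  moreover have "bounded ({0..} \<inter> \<rho> -` B)" if "bounded B" for B
    by (rule bounded_preimage_if_ge[of "real N + 1"]) (use that in \<open>auto simp: \<rho>_def\<close>)
  moreover have "\<rho> ` {0..} \<subseteq> {0..}" by (auto simp: \<rho>_def)
  moreover have "dY (f x) (f y) \<le> ennreal (\<rho> (enn2real (dX x y)))"
    if "x \<in> X" "y \<in> X" "dX x y < \<infinity>" for x y
  proof -
    define t where "t = enn2real (dX x y)"
    have t: "t \<ge> 0" "dX x y = ennreal t" using that(3) by (auto simp: t_def)
    have "dY (f x) (f y) \<le> of_nat N * (dX x y + 1)" using N that by blast
    also have "\<dots> = ennreal (real N * (t + 1))"
      using t(1) by (simp add: t(2) ennreal_mult ennreal_of_nat_eq_real_of_nat flip: ennreal_plus ennreal_1)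
    also have "\<dots> \<le> ennreal (\<rho> t)"
      using t(1) by (intro ennreal_leI) (simp add: \<rho>_def algebra_simps)
    finally show ?thesis by (simp add: t_def)
  qed
  ultimately have "upper_control X dX dY f \<rho>"
    by (simp add: upper_control_def control_function_def)
  then have "upper_control X dX dY f (\<lambda>t. (real N + 1) * t + real N)"
    by (simp add: \<rho>_def[abs_def])
  then show "coarsely_Lipschitz X dX Y dY f" using R by (auto simp: coarsely_Lipschitz_def)
qed

lemma coarsely_Lipschitz_imp_controlled:
  "coarsely_Lipschitz X dX Y dY f \<Longrightarrow> controlled X dX Y dY f"
  by (auto simp: coarsely_Lipschitz_def controlled_def)

lemma quasi_isometry_imp_coarse_equivalence:
  "quasi_isometry X dX Y dY f \<Longrightarrow> coarse_equivalence X dX Y dY f"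
  unfolding quasi_isometry_def coarse_equivalence_def
  by (blast intro: coarsely_Lipschitz_imp_controlled)

section \<open>Composition of maps and the preorder \<open>prec\<close>\<close>

lemma controlled_comp:
  assumes f: "controlled X dX Y dY f" and g: "controlled Y dY Z dZ g"
  shows "controlled X dX Z dZ (g \<circ> f)"
proof -
  have "\<exists>N::nat. \<forall>x\<in>X. \<forall>y\<in>X. dX x y \<le> of_nat n \<longrightarrow> dZ (g (f x)) (g (f y)) \<le> of_nat N" for n :: nat
  proof -
    obtain M :: nat where
      M: "\<And>x y. x \<in> X \<Longrightarrow> y \<in> X \<Longrightarrow> dX x y \<le> of_nat n \<Longrightarrow> dY (f x) (f y) \<le> of_nat M"
      using f unfolding controlled_iff by metis
    obtain N :: nat where
      "\<And>x y. x \<in> Y \<Longrightarrow> y \<in> Y \<Longrightarrow> dY x y \<le> of_nat M \<Longrightarrow> dZ (g x) (g y) \<le> of_nat N"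
      using g unfolding controlled_iff by metis
    moreover have "f ` X \<subseteq> Y" using f by (simp add: controlled_def)
    ultimately show ?thesis using M by (meson image_subset_iff)
  qed
  moreover have "(g \<circ> f) ` X \<subseteq> Z" using f g by (fastforce simp: controlled_def)
  ultimately show ?thesis by (simp add: controlled_iff)
qed

lemma controlled_id_trans:
  "controlled X d1 X d2 id \<Longrightarrow> controlled X d2 X d3 id \<Longrightarrow> controlled X d1 X d3 id"
  using controlled_comp[of X d1 X d2 id X d3 id] by simp

lemma prec_iff:
  "prec X d1 d2 \<longleftrightarrow> (\<exists>N::nat. \<forall>x\<in>X. \<forall>y\<in>X. d1 x y \<le> of_nat N * (d2 x y + 1))"
  by (simp add: prec_def coarsely_Lipschitz_iff)

lemma prec_imp_controlled: "prec X d1 d2 \<Longrightarrow> controlled X d2 X d1 id"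
  by (simp add: prec_def coarsely_Lipschitz_imp_controlled)

lemma prec_if_le_mult:
  assumes "\<And>x y. x \<in> X \<Longrightarrow> y \<in> X \<Longrightarrow> d1 x y \<le> of_nat N * d2 x y"
  shows "prec X d1 d2"
  unfolding prec_iff
proof (intro exI ballI)
  fix x y assume "x \<in> X" "y \<in> X"
  then have "d1 x y \<le> of_nat N * d2 x y" by (rule assms)
  also have "\<dots> \<le> of_nat N * (d2 x y + 1)" by (intro mult_left_mono) auto
  finally show "d1 x y \<le> of_nat N * (d2 x y + 1)" .
qed

lemma prec_trans:
  assumes "prec X d1 d2" "prec X d2 d3"
  shows "prec X d1 d3"
proof -
  obtain N :: nat where N: "\<And>x y. x \<in> X \<Longrightarrow> y \<in> X \<Longrightarrow> d1 x y \<le> of_nat N * (d2 x y + 1)"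
    using assms(1) unfolding prec_iff by blast
  obtain M :: nat where M: "\<And>x y. x \<in> X \<Longrightarrow> y \<in> X \<Longrightarrow> d2 x y \<le> of_nat M * (d3 x y + 1)"
    using assms(2) unfolding prec_iff by blast
  have "d1 x y \<le> of_nat (N * (M + 1)) * (d3 x y + 1)" if "x \<in> X" "y \<in> X" for x y
  proof -
    have "d1 x y \<le> of_nat N * (d2 x y + 1)" using N that .
    also have "\<dots> \<le> of_nat N * (of_nat M * (d3 x y + 1) + (d3 x y + 1))"
      using M[OF that] by (intro mult_left_mono add_mono) auto
    also have "\<dots> = of_nat (N * (M + 1)) * (d3 x y + 1)"
      by (simp add: distrib_left distrib_right mult.assoc add_ac)
    finally show ?thesis .
  qed
  then show ?thesis unfolding prec_iff by blast
qed

section \<open>Extended metrics and their coarse equivalence\<close>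

lemma ext_metricI:
  assumes "\<And>x y. x \<in> X \<Longrightarrow> y \<in> X \<Longrightarrow> d x y = 0 \<longleftrightarrow> x = y"
    and "\<And>x y. x \<in> X \<Longrightarrow> y \<in> X \<Longrightarrow> d x y = d y x"
    and "\<And>x y z. x \<in> X \<Longrightarrow> y \<in> X \<Longrightarrow> z \<in> X \<Longrightarrow> d x z \<le> d x y + d y z"
  shows "ext_metric X d"
  using assms unfolding ext_metric_def by blast

lemma
  assumes "ext_metric X d" "x \<in> X" "y \<in> X"
  shows ext_metric_zero: "d x y = 0 \<longleftrightarrow> x = y"
    and ext_metric_sym: "d x y = d y x"
    and ext_metric_triangle: "z \<in> X \<Longrightarrow> d x z \<le> d x y + d y z"
  using assms unfolding ext_metric_def by blast+

text \<open>A coarse inverse \<open>g\<close> of the identity moves every point by at most a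
  constant \<open>K\<close> in \<open>d\<close>. Replacing \<open>g x\<close> and \<open>g y\<close>
  by \<open>x\<close> and \<open>y\<close> therefore costs only \<open>2 * K\<close>, so the
  identity itself is controlled in the backward direction.\<close>

lemma coarsely_equivalent_metrics_iff:
  assumes d: "ext_metric X d" and d': "ext_metric X d'"
  shows "coarsely_equivalent_metrics X d d' \<longleftrightarrow>
    controlled X d X d' id \<and> controlled X d' X d id"
proof
  assume "coarsely_equivalent_metrics X d d'"
  then obtain g where id: "controlled X d X d' id" and g: "controlled X d' X d g"
    and close: "close X d (g \<circ> id) id"
    by (auto simp: coarsely_equivalent_metrics_def coarse_equivalence_def)
  obtain K :: nat where K: "\<And>x. x \<in> X \<Longrightarrow> d (g x) x \<le> of_nat K"
    using close unfolding close_iff by auto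
  have gX: "g x \<in> X" if "x \<in> X" for x using g that by (auto simp: controlled_def)
  have "\<exists>N::nat. \<forall>x\<in>X. \<forall>y\<in>X. d' x y \<le> of_nat n \<longrightarrow> d x y \<le> of_nat N" for n :: nat
  proof -
    obtain N :: nat where
      N: "\<And>x y. x \<in> X \<Longrightarrow> y \<in> X \<Longrightarrow> d' x y \<le> of_nat n \<Longrightarrow> d (g x) (g y) \<le> of_nat N"
      using g unfolding controlled_iff by metis
    have "d x y \<le> of_nat (K + (N + K))" if "x \<in> X" "y \<in> X" "d' x y \<le> of_nat n" for x y
    proof -
      have "d x y \<le> d x (g x) + d (g x) y" using d gX that by (simp add: ext_metric_triangle)
      also have "d (g x) y \<le> d (g x) (g y) + d (g y) y"
        using d gX that by (simp add: ext_metric_triangle)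
      also have "d x (g x) = d (g x) x" using d gX that by (simp add: ext_metric_sym)
      finally have "d x y \<le> d (g x) x + (d (g x) (g y) + d (g y) y)" by (simp add: add_left_mono)
      also have "\<dots> \<le> of_nat K + (of_nat N + of_nat K)"
        using K N that by (intro add_mono) auto
      finally show ?thesis by simp
    qed
    then show ?thesis by blast
  qed
  then show "controlled X d X d' id \<and> controlled X d' X d id" using id by (simp add: controlled_iff)
next
  assume "controlled X d X d' id \<and> controlled X d' X d id"
  moreover have "close X d id id" "close X d' id id"
    unfolding close_iff using d d' by (auto simp: ext_metric_zero intro!: exI[of _ 0])
  ultimately show "coarsely_equivalent_metrics X d d'"
    unfolding coarsely_equivalent_metrics_def coarse_equivalence_def
    by (intro conjI exI[of _ id]) auto
qed

text \<open>The same pair of maps works for both metrics: control passes through the identity, which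
  also turns the closeness bound for \<open>d'\<close> into one for \<open>d\<close>.\<close>

lemma coarse_equivalence_cong_metric:
  assumes "coarse_equivalence X d' Y dY f" "controlled X d X d' id" "controlled X d' X d id"
  shows "coarse_equivalence X d Y dY f"
proof -
  obtain g where f: "controlled X d' Y dY f" and g: "controlled Y dY X d' g"
    and close: "close X d' (g \<circ> f) id" "close Y dY (f \<circ> g) id"
    using assms(1) by (auto simp: coarse_equivalence_def)
  obtain K :: nat where K: "\<And>x. x \<in> X \<Longrightarrow> d' (g (f x)) x \<le> of_nat K"
    using close(1) unfolding close_iff by auto
  obtain N :: nat where N: "\<And>x y. x \<in> X \<Longrightarrow> y \<in> X \<Longrightarrow> d' x y \<le> of_nat K \<Longrightarrow> d x y \<le> of_nat N"
    using assms(3) unfolding controlled_iff by fastforce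
  have "g (f x) \<in> X" if "x \<in> X" for x using f g that by (auto simp: controlled_def)
  then have "close X d (g \<circ> f) id" unfolding close_iff using K N by (auto intro!: exI[of _ N])
  then show ?thesis
    using controlled_comp[OF assms(2) f] controlled_comp[OF g assms(3)] close(2)
    unfolding coarse_equivalence_def by auto
qed

section \<open>Graph distances\<close>

lemma graph_dist_le: "(u, v) \<in> E ^^ n \<Longrightarrow> graph_dist E u v \<le> of_nat n"
  unfolding graph_dist_def by (rule INF_lower) simp

text \<open>The infimum is attained by a shortest walk if there is any walk, and otherwise runs over
  the empty set.\<close>

lemma graph_dist_cases:
  obtains (finite) n where "(u, v) \<in> E ^^ n" "graph_dist E u v = of_nat n"
  | (infinite) "graph_dist E u v = top"
proof (cases "\<exists>n. (u, v) \<in> E ^^ n")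
  case True
  define n where "n = (LEAST n. (u, v) \<in> E ^^ n)"
  have n: "(u, v) \<in> E ^^ n" using True unfolding n_def by (rule LeastI_ex)
  have "n \<le> k" if "(u, v) \<in> E ^^ k" for k unfolding n_def using that by (rule Least_le)
  then have "of_nat n \<le> graph_dist E u v" unfolding graph_dist_def by (auto intro!: INF_greatest)
  then show ?thesis using finite n graph_dist_le[OF n] by auto
next
  case False
  then show ?thesis using infinite by (simp add: graph_dist_def)
qed

lemma relpow_sym: "sym E \<Longrightarrow> (u, v) \<in> E ^^ n \<Longrightarrow> (v, u) \<in> E ^^ n"
proof (induction n arbitrary: v)
  case (Suc n)
  then obtain w where "(u, w) \<in> E ^^ n" "(w, v) \<in> E" by auto
  then have "(v, w) \<in> E" "(w, u) \<in> E ^^ n" using Suc by (auto dest: symD)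
  then show ?case by (rule relpow_Suc_I2)
qed simp

lemma ext_metric_graph_dist:
  assumes "sym E"
  shows "ext_metric X (graph_dist E)"
proof (rule ext_metricI)
  fix x y
  show "graph_dist E x y = 0 \<longleftrightarrow> x = y"
  proof
    show "x = y" if "graph_dist E x y = 0"
      by (rule graph_dist_cases[of x y E]) (use that in auto)
    show "graph_dist E x y = 0" if "x = y"
      using that graph_dist_le[of x y 0 E] by simp
  qed
next
  fix x y
  have "{n. (x, y) \<in> E ^^ n} = {n. (y, x) \<in> E ^^ n}" using relpow_sym[OF assms] by blast
  then show "graph_dist E x y = graph_dist E y x" by (simp add: graph_dist_def)
next
  fix x y z
  show "graph_dist E x z \<le> graph_dist E x y + graph_dist E y z"
  proof (cases rule: graph_dist_cases[of x y E])
    case n: (finite n)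
    show ?thesis
    proof (cases rule: graph_dist_cases[of y z E])
      case m: (finite m)
      have "(x, z) \<in> E ^^ (n + m)" using n(1) m(1) by (auto simp: relpow_add)
      then show ?thesis using n(2) m(2) graph_dist_le by fastforce
    qed simp
  qed simp
qed

text \<open>Positivity of \<open>N\<close> matters for vertices in different components, since \<open>0 * \<infinity> = 0\<close>.\<close>

lemma le_mult_graph_dist:
  assumes E: "E \<subseteq> V \<times> V" and d: "ext_metric X d" and g: "g ` V \<subseteq> X" and "N > 0"
    and edge: "\<And>u v. (u, v) \<in> E \<Longrightarrow> d (g u) (g v) \<le> of_nat N"
    and u: "u \<in> V" and v: "v \<in> V"
  shows "d (g u) (g v) \<le> of_nat N * graph_dist E u v"
proof (cases rule: graph_dist_cases[of u v E])
  case (finite n)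
  \<comment> \<open>Membership of the endpoint in \<open>V\<close> is carried along so that its
    image lies in \<open>X\<close>, where the triangle inequality holds.\<close>
  have "(u, w) \<in> E ^^ k \<Longrightarrow> w \<in> V \<and> d (g u) (g w) \<le> of_nat N * of_nat k" for k w
  proof (induction k arbitrary: w)
    case 0
    have "d (g u) (g u) = 0" using ext_metric_zero[OF d] g u by blast
    then show ?case using 0 u by simp
  next
    case (Suc k)
    then obtain w' where w': "(u, w') \<in> E ^^ k" "(w', w) \<in> E" by auto
    have V: "w' \<in> V" "w \<in> V" using w' E by auto
    have "d (g u) (g w) \<le> d (g u) (g w') + d (g w') (g w)"
      using ext_metric_triangle[OF d] g u V by blast
    also have "\<dots> \<le> of_nat N * of_nat k + of_nat N"
      using Suc.IH[OF w'(1)] edge[OF w'(2)] by (intro add_mono) auto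
    also have "\<dots> = of_nat N * of_nat (Suc k)" by (simp add: distrib_left add.commute)
    finally show ?case using V by simp
  qed
  then show ?thesis using finite by simp
next
  case infinite
  then show ?thesis using \<open>N > 0\<close> by (simp add: ennreal_mult_top)
qed

text \<open>A walk starting in the image of \<open>h\<close> never leaves it, and injectivity allows
  each of its edges to be pulled back. Hence relabelling preserves the lengths of walks.\<close>

lemma relpow_map_prod_inj:
  assumes "inj h"
  shows "(h u, w) \<in> (map_prod h h ` E) ^^ n \<longleftrightarrow> (\<exists>v. w = h v \<and> (u, v) \<in> E ^^ n)"
proof (induction n arbitrary: w)
  case (Suc n)
  show ?case
  proof
    assume "(h u, w) \<in> (map_prod h h ` E) ^^ Suc n"
    then obtain w' where "(h u, w') \<in> (map_prod h h ` E) ^^ n" "(w', w) \<in> map_prod h h ` E" by auto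
    then show "\<exists>v. w = h v \<and> (u, v) \<in> E ^^ Suc n"
      using Suc.IH assms by (auto dest: injD)
  next
    assume "\<exists>v. w = h v \<and> (u, v) \<in> E ^^ Suc n"
    then obtain v v' where "w = h v" "(u, v') \<in> E ^^ n" "(v', v) \<in> E" by auto
    then show "(h u, w) \<in> (map_prod h h ` E) ^^ Suc n"
      using Suc.IH[of "h v'"] by (auto intro!: relcompI)
  qed
qed (use assms in \<open>auto dest: injD\<close>)

lemma graph_dist_map_prod_inj:
  assumes "inj h"
  shows "graph_dist (map_prod h h ` E) (h u) (h v) = graph_dist E u v"
  using assms by (simp add: graph_dist_def relpow_map_prod_inj inj_eq)

text \<open>The graph already lives on \<open>X\<close>; a copy along \<open>Inl\<close> moves it
  into the required vertex type, with \<open>projl\<close> as inverse isometry.\<close>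

lemma quasigeodesic_graph_dist:
  fixes X :: "'a set"
  assumes E: "simple_graph X E"
  shows "quasigeodesic TYPE('a + 'v) X (graph_dist E)"
proof -
  let ?h = "Inl :: 'a \<Rightarrow> 'a + 'v"
  define F where "F = map_prod ?h ?h ` E"
  have F: "graph_dist F (?h x) (?h y) = graph_dist E x y" for x y
    unfolding F_def by (rule graph_dist_map_prod_inj) simp
  have [simp]: "graph_dist E x x = 0" for x
    using graph_dist_le[of x x 0 E] by simp
  have "simple_graph (?h ` X) F"
    using E unfolding simple_graph_def F_def
    by (auto simp: sym_def irrefl_def map_prod_def)
  moreover have "quasi_isometry X (graph_dist E) (?h ` X) (graph_dist F) ?h"
    unfolding quasi_isometry_def
  proof (intro conjI exI[of _ projl])
    have *: "graph_dist E x y \<le> of_nat 1 * (graph_dist E x y + 1)" for x y by simp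
    show "coarsely_Lipschitz X (graph_dist E) (?h ` X) (graph_dist F) ?h"
      and "coarsely_Lipschitz (?h ` X) (graph_dist F) X (graph_dist E) projl"
      unfolding coarsely_Lipschitz_iff
      by (auto simp: F simp del: of_nat_1 intro!: exI[of _ "1::nat"] *)
    show "close X (graph_dist E) (projl \<circ> ?h) id" "close (?h ` X) (graph_dist F) (?h \<circ> projl) id"
      unfolding close_iff by (auto simp: F)
  qed
  ultimately show ?thesis unfolding quasigeodesic_def by blast
qed

section \<open>Step graphs of a metric\<close>

text \<open>This is the graph \<open>G n\<close> of the overview, the 1-skeleton of the
  Vietoris-Rips complex at scale \<open>n\<close>. The diagonal is removed because a
  \<open>simple_graph\<close> has no loops.\<close>

definition step_graph :: "'a set \<Rightarrow> ('a \<Rightarrow> 'a \<Rightarrow> ennreal) \<Rightarrow> nat \<Rightarrow> ('a \<times> 'a) set" where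
  "step_graph X d n = {(x, y). x \<in> X \<and> y \<in> X \<and> x \<noteq> y \<and> d x y \<le> of_nat n}"

abbreviation step_dist :: "'a set \<Rightarrow> ('a \<Rightarrow> 'a \<Rightarrow> ennreal) \<Rightarrow> nat \<Rightarrow> 'a \<Rightarrow> 'a \<Rightarrow> ennreal" where
  "step_dist X d n \<equiv> graph_dist (step_graph X d n)"

lemma simple_graph_step_graph:
  assumes "ext_metric X d"
  shows "simple_graph X (step_graph X d n)"
  using ext_metric_sym[OF assms]
  by (auto simp: simple_graph_def step_graph_def sym_def irrefl_def)

lemma ext_metric_step_dist: "ext_metric X d \<Longrightarrow> ext_metric X (step_dist X d n)"
  using simple_graph_step_graph ext_metric_graph_dist unfolding simple_graph_def by blast

lemma step_dist_le_1:
  assumes "x \<in> X" "y \<in> X" "d x y \<le> of_nat n"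
  shows "step_dist X d n x y \<le> 1"
proof (cases "x = y")
  case True
  then show ?thesis using graph_dist_le[of x y 0] by simp
next
  case False
  then have "(x, y) \<in> step_graph X d n ^^ 1" using assms by (simp add: step_graph_def)
  from graph_dist_le[OF this] show ?thesis by simp
qed

text \<open>Edges of the step graph have bounded \<open>d\<close>-length, hence bounded
  \<open>m\<close>-length, and a bound on edges extends linearly along walks.\<close>

lemma prec_step_dist_if_controlled:
  assumes "ext_metric X d" "ext_metric X m" "controlled X d X m id"
  shows "prec X m (step_dist X d n)"
proof -
  obtain N :: nat where N: "\<And>x y. x \<in> X \<Longrightarrow> y \<in> X \<Longrightarrow> d x y \<le> of_nat n \<Longrightarrow> m x y \<le> of_nat N"
    using assms(3) unfolding controlled_iff by fastforce
  \<comment> \<open>\<open>Suc N\<close> supplies the positive constant that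
    \<open>le_mult_graph_dist\<close> asks for.\<close>
  have "m (id x) (id y) \<le> of_nat (Suc N) * step_dist X d n x y" if "x \<in> X" "y \<in> X" for x y
  proof (rule le_mult_graph_dist[OF _ assms(2)])
    show "step_graph X d n \<subseteq> X \<times> X" by (auto simp: step_graph_def)
    show "m (id u) (id v) \<le> of_nat (Suc N)" if "(u, v) \<in> step_graph X d n" for u v
      using N[of u v] that by (auto simp: step_graph_def intro: add_increasing)
  qed (use that in auto)
  then show ?thesis by (intro prec_if_le_mult[of X m "Suc N"]) auto
qed

lemma prec_step_dist: "ext_metric X d \<Longrightarrow> prec X d (step_dist X d n)"
  by (intro prec_step_dist_if_controlled) (auto simp: controlled_iff)

text \<open>Applying \<open>g\<close> to a walk from \<open>f x\<close> to \<open>f y\<close> gives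
  a sequence of points with consecutive \<open>d\<close>-distances at most \<open>N\<close>, while
  its ends are within \<open>K\<close> of \<open>x\<close> and \<open>y\<close>. At scale
  \<open>max K N\<close> all these jumps are single steps, and correcting the two ends accounts for
  the summand \<open>2\<close>.\<close>

lemma step_dist_le_graph_dist:
  assumes d: "ext_metric X d" and E: "simple_graph V E" and f: "f ` X \<subseteq> V"
    and g: "controlled V (graph_dist E) X d g" and close: "close X d (g \<circ> f) id"
  obtains n where "\<And>x y. x \<in> X \<Longrightarrow> y \<in> X \<Longrightarrow> step_dist X d n x y \<le> graph_dist E (f x) (f y) + 2"
proof -
  obtain K :: nat where K: "\<And>x. x \<in> X \<Longrightarrow> d (g (f x)) x \<le> of_nat K"
    using close unfolding close_iff by auto
  obtain N :: nat where N:
    "\<And>u v. u \<in> V \<Longrightarrow> v \<in> V \<Longrightarrow> graph_dist E u v \<le> of_nat 1 \<Longrightarrow> d (g u) (g v) \<le> of_nat N"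
    using g unfolding controlled_iff by metis
  define n where "n = max K N"
  let ?s = "step_dist X d n"
  have s: "ext_metric X ?s" using d by (rule ext_metric_step_dist)
  have gX: "g v \<in> X" if "v \<in> V" for v using g that by (auto simp: controlled_def)
  have EV: "E \<subseteq> V \<times> V" using E by (simp add: simple_graph_def)
  have edge: "?s (g u) (g v) \<le> of_nat 1" if "(u, v) \<in> E" for u v
  proof -
    have "graph_dist E u v \<le> of_nat 1" using that by (intro graph_dist_le) simp
    then have "d (g u) (g v) \<le> of_nat N" using N that EV by auto
    also have "of_nat N \<le> (of_nat n :: ennreal)" by (simp add: n_def)
    finally have "?s (g u) (g v) \<le> 1" using that EV gX by (intro step_dist_le_1) auto
    then show ?thesis by simp
  qed
  have near: "?s (g (f x)) x \<le> 1" if "x \<in> X" for x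
  proof (rule step_dist_le_1)
    have "of_nat K \<le> (of_nat n :: ennreal)" by (simp add: n_def)
    then show "d (g (f x)) x \<le> of_nat n" using K[OF that] order_trans by blast
  qed (use that f gX in auto)
  have "?s x y \<le> graph_dist E (f x) (f y) + 2" if xy: "x \<in> X" "y \<in> X" for x y
  proof -
    have V: "f x \<in> V" "f y \<in> V" using f xy by auto
    have "?s x y \<le> ?s x (g (f x)) + ?s (g (f x)) y"
      using ext_metric_triangle[OF s] xy V gX by blast
    also have "\<dots> \<le> ?s x (g (f x)) + (?s (g (f x)) (g (f y)) + ?s (g (f y)) y)"
      using ext_metric_triangle[OF s] xy V gX by (intro add_left_mono) blast
    also have "\<dots> \<le> 1 + (of_nat 1 * graph_dist E (f x) (f y) + 1)"
    proof (intro add_mono)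
      show "?s x (g (f x)) \<le> 1" using near[OF xy(1)] ext_metric_sym[OF s] xy V gX by metis
      show "?s (g (f x)) (g (f y)) \<le> of_nat 1 * graph_dist E (f x) (f y)"
        by (rule le_mult_graph_dist[OF EV s]) (use gX edge V in auto)
    qed (rule near[OF xy(2)])
    also have "\<dots> = graph_dist E (f x) (f y) + 2"
      by (simp add: add.commute add.left_commute flip: one_add_one)
    finally show ?thesis .
  qed
  then show thesis by (rule that)
qed

section \<open>Step distances of coarsely geodesic and quasigeodesic metrics\<close>

lemma coarsely_geodesic_imp_controlled_step_dist:
  assumes d: "ext_metric X d" and "coarsely_geodesic T X d"
  obtains n where "controlled X d X (step_dist X d n) id"
proof -
  obtain V :: "'b set" and E f where E: "simple_graph V E"
    and "coarse_equivalence X d V (graph_dist E) f"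
    using assms(2) unfolding coarsely_geodesic_def by blast
  then obtain g where f: "controlled X d V (graph_dist E) f"
    and g: "controlled V (graph_dist E) X d g" "close X d (g \<circ> f) id"
    by (auto simp: coarse_equivalence_def)
  have "f ` X \<subseteq> V" using f by (simp add: controlled_def)
  from step_dist_le_graph_dist[OF d E this g] obtain n where
    n: "\<And>x y. x \<in> X \<Longrightarrow> y \<in> X \<Longrightarrow> step_dist X d n x y \<le> graph_dist E (f x) (f y) + 2" by blast
  have "\<exists>N::nat. \<forall>x\<in>X. \<forall>y\<in>X. d x y \<le> of_nat k \<longrightarrow> step_dist X d n x y \<le> of_nat N" for k :: nat
  proof -
    obtain N :: nat where
      N: "\<And>x y. x \<in> X \<Longrightarrow> y \<in> X \<Longrightarrow> d x y \<le> of_nat k \<Longrightarrow> graph_dist E (f x) (f y) \<le> of_nat N"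
      using f unfolding controlled_iff by metis
    have "step_dist X d n x y \<le> of_nat (N + 2)" if "x \<in> X" "y \<in> X" "d x y \<le> of_nat k" for x y
      using order_trans[OF n add_right_mono[OF N]] that by (simp only: of_nat_add of_nat_numeral)
    then show ?thesis by blast
  qed
  then have "controlled X d X (step_dist X d n) id" by (simp add: controlled_iff)
  then show thesis by (rule that)
qed

lemma quasigeodesic_imp_step_dist_prec:
  assumes d: "ext_metric X d" and "quasigeodesic T X d"
  obtains n where "prec X (step_dist X d n) d"
proof -
  obtain V :: "'b set" and E f where E: "simple_graph V E"
    and "quasi_isometry X d V (graph_dist E) f"
    using assms(2) unfolding quasigeodesic_def by blast
  then obtain g where f: "coarsely_Lipschitz X d V (graph_dist E) f"
    and g: "coarsely_Lipschitz V (graph_dist E) X d g" "close X d (g \<circ> f) id"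
    by (auto simp: quasi_isometry_def)
  have fX: "f ` X \<subseteq> V" using f by (simp add: coarsely_Lipschitz_def)
  from step_dist_le_graph_dist[OF d E fX coarsely_Lipschitz_imp_controlled[OF g(1)] g(2)]
  obtain n where
    n: "\<And>x y. x \<in> X \<Longrightarrow> y \<in> X \<Longrightarrow> step_dist X d n x y \<le> graph_dist E (f x) (f y) + 2" by blast
  obtain N :: nat where
    N: "\<And>x y. x \<in> X \<Longrightarrow> y \<in> X \<Longrightarrow> graph_dist E (f x) (f y) \<le> of_nat N * (d x y + 1)"
    using f unfolding coarsely_Lipschitz_iff by metis
  have "step_dist X d n x y \<le> of_nat (N + 2) * (d x y + 1)" if "x \<in> X" "y \<in> X" for x y
  proof -
    \<comment> \<open>The additive \<open>2\<close> is absorbed as \<open>2 * (d x y + 1)\<close>,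
      whence the constant \<open>N + 2\<close>.\<close>
    have "step_dist X d n x y \<le> of_nat N * (d x y + 1) + 2 * 1"
      using order_trans[OF n add_right_mono[OF N]] that by simp
    also have "\<dots> \<le> of_nat N * (d x y + 1) + 2 * (d x y + 1)"
      by (intro add_left_mono mult_left_mono) auto
    finally show ?thesis by (simp only: of_nat_add of_nat_numeral distrib_right)
  qed
  then show thesis using that unfolding prec_iff by blast
qed

text \<open>Out of a quasigeodesic metric, control improves to a coarse Lipschitz bound:
  \<open>m\<close> lies below every step distance of \<open>d\<close>, and one of these lies below
  \<open>d\<close>. Both extremality statements rest on this.\<close>

lemma quasigeodesic_prec_if_controlled:
  assumes "ext_metric X d" "quasigeodesic T X d" "ext_metric X m" "controlled X d X m id"
  shows "prec X m d"
  using assms quasigeodesic_imp_step_dist_prec prec_step_dist_if_controlled prec_trans by metis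

lemma coarsely_geodesic_if_controlled:
  assumes "quasigeodesic T X d'" "controlled X d X d' id" "controlled X d' X d id"
  shows "coarsely_geodesic T X d"
  using assms coarse_equivalence_cong_metric quasi_isometry_imp_coarse_equivalence
  unfolding coarsely_geodesic_def quasigeodesic_def by metis

section \<open>Truncations and suprema of metrics\<close>

lemma ext_metric_min_const:
  assumes d: "ext_metric X d" and "c > 0"
  shows "ext_metric X (\<lambda>x y. min (d x y) c)"
proof (rule ext_metricI)
  fix x y assume "x \<in> X" "y \<in> X"
  then show "min (d x y) c = 0 \<longleftrightarrow> x = y" "min (d x y) c = min (d y x) c"
    using ext_metric_zero[OF d, of x y] ext_metric_sym[OF d, of x y] \<open>c > 0\<close>
    by (auto simp: min_def)
next
  fix x y z assume "x \<in> X" "y \<in> X" "z \<in> X"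
  then have "d x z \<le> d x y + d y z" by (rule ext_metric_triangle[OF d])
  then show "min (d x z) c \<le> min (d x y) c + min (d y z) c"
    by (auto simp: min_def intro: add_increasing add_increasing2)
qed

text \<open>The index set must be nonempty because an empty supremum is constantly \<open>0\<close>
  and does not separate points.\<close>

lemma ext_metric_SUP:
  assumes "I \<noteq> {}" and d: "\<And>i. i \<in> I \<Longrightarrow> ext_metric X (d i)"
  shows "ext_metric X (\<lambda>x y. SUP i\<in>I. d i x y)"
proof (rule ext_metricI)
  fix x y assume xy: "x \<in> X" "y \<in> X"
  have "(SUP i\<in>I. d i x y) = 0 \<longleftrightarrow> (\<forall>i\<in>I. d i x y = 0)"
    by (metis (no_types, lifting) SUP_bot_conv(1) bot_ennreal)
  then show "(SUP i\<in>I. d i x y) = 0 \<longleftrightarrow> x = y"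
    using ext_metric_zero[OF d] xy \<open>I \<noteq> {}\<close> by blast
  show "(SUP i\<in>I. d i x y) = (SUP i\<in>I. d i y x)"
    using ext_metric_sym[OF d] xy by (intro SUP_cong) auto
next
  fix x y z assume xyz: "x \<in> X" "y \<in> X" "z \<in> X"
  show "(SUP i\<in>I. d i x z) \<le> (SUP i\<in>I. d i x y) + (SUP i\<in>I. d i y z)"
  proof (rule SUP_least)
    fix i assume i: "i \<in> I"
    have "d i x z \<le> d i x y + d i y z" using ext_metric_triangle[OF d[OF i]] xyz by blast
    also have "\<dots> \<le> (SUP i\<in>I. d i x y) + (SUP i\<in>I. d i y z)"
      using i by (intro add_mono SUP_upper)
    finally show "d i x z \<le> \<dots>" .
  qed
qed

lemma ext_metric_max:
  assumes "ext_metric X d1" "ext_metric X d2"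
  shows "ext_metric X (\<lambda>x y. max (d1 x y) (d2 x y))"
proof -
  have "ext_metric X (\<lambda>x y. SUP b\<in>UNIV. (if b then d1 else d2) x y)"
    using assms by (intro ext_metric_SUP) auto
  then show ?thesis by (simp add: UNIV_bool sup_max max.commute)
qed

text \<open>
  If no \<open>step_dist X m n\<close> lies below \<open>m\<close>, pick for each \<open>n\<close> a pair that violates the bound with
  constant \<open>n + 1\<close>. Truncating \<open>step_dist X m n\<close> just at the violated bound \<open>c n\<close> and taking the
  supremum over \<open>n\<close> gives a metric that is not below \<open>m\<close>; it is still coarsely equivalent to \<open>m\<close>,
  because on pairs with \<open>m u v \<le> k\<close> all but the first \<open>k\<close> terms are at most \<open>1\<close>.
\<close>

lemma step_dist_prec_if_maximal:
  assumes m: "ext_metric X m"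
    and max: "\<And>m'. ext_metric X m' \<Longrightarrow> controlled X m X m' id \<Longrightarrow> prec X m m' \<Longrightarrow> prec X m' m"
  obtains n where "prec X (step_dist X m n) m"
proof (rule ccontr)
  assume "\<not> thesis"
  then have "\<forall>n. \<exists>x\<in>X. \<exists>y\<in>X. \<not> step_dist X m n x y \<le> of_nat (Suc n) * (m x y + 1)"
    using that unfolding prec_iff by blast
  then obtain x y where xy: "\<And>n. x n \<in> X" "\<And>n. y n \<in> X"
    and viol: "\<And>n. of_nat (Suc n) * (m (x n) (y n) + 1) < step_dist X m n (x n) (y n)"
    unfolding not_le by metis
  define c :: "nat \<Rightarrow> ennreal" where "c n = of_nat (Suc n) * (m (x n) (y n) + 1)" for n
  \<comment> \<open>Strictness of the violation makes \<open>c n\<close> finite, which is needed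
    both for the bounds on \<open>m'\<close> and for the final cancellation.\<close>
  have c_fin: "c n < top" for n
    using viol[of n] unfolding c_def by (rule order_less_le_trans) simp
  have c_pos: "c n > 0" for n by (auto simp: c_def zero_less_iff_neq_zero)
  define m' where "m' u v = max (m u v) (SUP n. min (step_dist X m n u v) (c n))" for u v
  have m': "ext_metric X m'"
    unfolding m'_def
    by (intro ext_metric_max ext_metric_SUP ext_metric_min_const ext_metric_step_dist m c_pos) auto
  have "\<exists>N::nat. \<forall>u\<in>X. \<forall>v\<in>X. m u v \<le> of_nat k \<longrightarrow> m' u v \<le> of_nat N" for k :: nat
  proof -
    \<comment> \<open>The summands bound, in this order, \<open>m\<close> itself, the terms of index
      at least \<open>k\<close>, and the truncated terms of index below \<open>k\<close>.\<close>
    have "of_nat k + 1 + (\<Sum>i<k. c i) < top" using c_fin by (simp add: of_nat_less_top)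
    then obtain N :: nat where N: "of_nat k + 1 + (\<Sum>i<k. c i) \<le> of_nat N"
      using ennreal_Ex_less_of_nat less_imp_le by blast
    have "m' u v \<le> of_nat k + 1 + (\<Sum>i<k. c i)" if uv: "u \<in> X" "v \<in> X" "m u v \<le> of_nat k" for u v
      unfolding m'_def
    proof (intro max.boundedI SUP_least)
      show "m u v \<le> of_nat k + 1 + (\<Sum>i<k. c i)"
        using uv(3) by (simp add: add_increasing2)
      fix n
      show "min (step_dist X m n u v) (c n) \<le> of_nat k + 1 + (\<Sum>i<k. c i)"
      proof (cases "n < k")
        case True
        then have "c n \<le> (\<Sum>i<k. c i)" by (intro member_le_sum) auto
        then show ?thesis by (simp add: min.coboundedI2 add_increasing)
      next
        case False
        then have "(of_nat k :: ennreal) \<le> of_nat n" by simp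
        then have "step_dist X m n u v \<le> 1"
          using uv by (intro step_dist_le_1) (auto intro: order_trans)
        then show ?thesis by (simp add: min.coboundedI1 add_increasing add_increasing2)
      qed
    qed
    then show ?thesis using N order_trans by blast
  qed
  then have "controlled X m X m' id" by (simp add: controlled_iff)
  moreover have "prec X m m'" by (rule prec_if_le_mult[of _ _ 1]) (simp add: m'_def)
  ultimately have "prec X m' m" using max m' by blast
  then obtain N :: nat where N: "\<And>u v. u \<in> X \<Longrightarrow> v \<in> X \<Longrightarrow> m' u v \<le> of_nat N * (m u v + 1)"
    unfolding prec_iff by blast
  have "c N = min (step_dist X m N (x N) (y N)) (c N)"
    using viol[of N] unfolding c_def by (simp only: min_absorb2 less_imp_le)
  also have "\<dots> \<le> m' (x N) (y N)" unfolding m'_def by (intro max.coboundedI2 SUP_upper) simp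
  also have "\<dots> \<le> of_nat N * (m (x N) (y N) + 1)" using N xy by blast
  finally have le: "c N \<le> of_nat N * (m (x N) (y N) + 1)" .
  \<comment> \<open>The supposed constant \<open>N\<close> doubles as the index. Since
    \<open>c N\<close> has the factor \<open>N + 1\<close>, it exceeds the supposed bound by one
    copy of \<open>m (x N) (y N) + 1\<close>; cancelling the finite rest leaves a
    contradiction.\<close>
  have "c N = of_nat N * (m (x N) (y N) + 1) + (m (x N) (y N) + 1)"
    by (simp only: c_def of_nat_Suc distrib_right mult_1_left add.commute)
  moreover from this have "of_nat N * (m (x N) (y N) + 1) \<noteq> top"
    using c_fin[of N] by (metis ennreal_add_eq_top less_irrefl)
  ultimately have "m (x N) (y N) + 1 \<le> 0"
    using le ennreal_add_left_cancel_le[of "of_nat N * (m (x N) (y N) + 1)" "m (x N) (y N) + 1" 0]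
    by (metis add.right_neutral infinity_ennreal_def)
  then show False by simp
qed

section \<open>Extremal metrics\<close>

lemma mem_coarse_class_iff:
  assumes "ext_metric X d"
  shows "m \<in> coarse_class X d \<longleftrightarrow>
    ext_metric X m \<and> controlled X d X m id \<and> controlled X m X d id"
  using coarsely_equivalent_metrics_iff[OF assms] by (auto simp: coarse_class_def)

text \<open>The comparisons are obtained with every member of the two sets, so \<open>m\<close> is
  in fact greatest in the first and least in the second. In the second case the identity from
  \<open>m1\<close> to \<open>m\<close> is controlled through \<open>d\<close>, and
  \<open>m1\<close> being quasigeodesic makes it coarsely Lipschitz.\<close>

lemma quasigeodesic_extremal:
  assumes d: "ext_metric X d" and m: "m \<in> coarse_class X d" and q: "quasigeodesic T X m"
  shows "prec_maximal X (coarse_class X d) m" "prec_minimal X (quasigeodesic_above T X d) m"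
proof -
  note mem = mem_coarse_class_iff[OF d]
  have m': "ext_metric X m" "controlled X d X m id" "controlled X m X d id"
    using m by (auto simp: mem)
  show "prec_maximal X (coarse_class X d) m"
    unfolding prec_maximal_def
  proof (intro conjI ballI impI m)
    fix m1 assume "m1 \<in> coarse_class X d"
    then have "ext_metric X m1" "controlled X m X m1 id"
      using m' controlled_id_trans by (auto simp: mem)
    then show "prec X m1 m" using quasigeodesic_prec_if_controlled m'(1) q by blast
  qed
  have "m \<in> quasigeodesic_above T X d"
    using quasigeodesic_prec_if_controlled m' q d by (auto simp: quasigeodesic_above_def)
  moreover have "prec X m m1" if "m1 \<in> quasigeodesic_above T X d" for m1
  proof -
    have m1: "ext_metric X m1" "quasigeodesic T X m1" "controlled X m1 X d id"
      using that prec_imp_controlled by (auto simp: quasigeodesic_above_def)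
    then show ?thesis
      using quasigeodesic_prec_if_controlled m' controlled_id_trans by blast
  qed
  ultimately show "prec_minimal X (quasigeodesic_above T X d) m"
    by (simp add: prec_minimal_def)
qed

text \<open>A step distance of \<open>m\<close> that lies below \<open>m\<close> also lies above it,
  so it is coarsely equivalent to \<open>m\<close> and thus to \<open>d\<close>; as a graph distance
  it is quasigeodesic.\<close>

lemma coarsely_geodesic_if_maximal:
  fixes X :: "'a set"
  assumes d: "ext_metric X d" and max: "prec_maximal X (coarse_class X d) m"
  shows "coarsely_geodesic TYPE('a + 'v) X d"
proof -
  note mem = mem_coarse_class_iff[OF d]
  have m: "ext_metric X m" "controlled X d X m id" "controlled X m X d id"
    using max by (auto simp: prec_maximal_def mem)
  \<comment> \<open>A competitor that is controlled by \<open>m\<close> and lies above it stays in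
    the coarse class of \<open>d\<close>, so maximality applies.\<close>
  have "prec X m' m" if "ext_metric X m'" "controlled X m X m' id" "prec X m m'" for m'
  proof -
    have "m' \<in> coarse_class X d"
      using that m prec_imp_controlled controlled_id_trans unfolding mem by blast
    then show ?thesis using max that(3) by (auto simp: prec_maximal_def)
  qed
  from step_dist_prec_if_maximal[OF m(1) this] obtain n where "prec X (step_dist X m n) m" by blast
  then have "controlled X d X (step_dist X m n) id" "controlled X (step_dist X m n) X d id"
    using prec_imp_controlled prec_step_dist m controlled_id_trans by blast+
  then show ?thesis
    using coarsely_geodesic_if_controlled quasigeodesic_graph_dist simple_graph_step_graph m(1)
    by blast
qed

text \<open>It remains to control \<open>m\<close> by \<open>d\<close>. Step distances of
  \<open>d\<close> at large scales lie below a step distance of \<open>m\<close>, hence below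
  \<open>m\<close>; minimality reverses this and bounds \<open>m\<close> on their edges.\<close>

lemma coarsely_geodesic_if_minimal:
  fixes X :: "'a set"
  assumes d: "ext_metric X d" and min: "prec_minimal X (quasigeodesic_above TYPE('a + 'v) X d) m"
  shows "coarsely_geodesic TYPE('a + 'v) X d"
proof -
  have m: "ext_metric X m" "quasigeodesic TYPE('a + 'v) X m" "controlled X m X d id"
    using min prec_imp_controlled by (auto simp: prec_minimal_def quasigeodesic_above_def)
  obtain r where r: "prec X (step_dist X m r) m"
    using quasigeodesic_imp_step_dist_prec m(1,2) by blast
  obtain R :: nat where R: "\<And>x y. x \<in> X \<Longrightarrow> y \<in> X \<Longrightarrow> m x y \<le> of_nat r \<Longrightarrow> d x y \<le> of_nat R"
    using m(3) unfolding controlled_iff by fastforce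
  have "\<exists>N::nat. \<forall>x\<in>X. \<forall>y\<in>X. d x y \<le> of_nat k \<longrightarrow> m x y \<le> of_nat N" for k :: nat
  proof -
    \<comment> \<open>The part \<open>R\<close> makes every edge of the step graph of
      \<open>m\<close> at scale \<open>r\<close> a single step for \<open>d\<close>; the part
      \<open>k\<close> does the same for the pairs on which \<open>m\<close> is to be
      bounded.\<close>
    define n where "n = k + R"
    let ?s = "step_dist X d n"
    have s: "ext_metric X ?s" using d by (rule ext_metric_step_dist)
    have "?s (id x) (id y) \<le> of_nat 1 * step_dist X m r x y" if "x \<in> X" "y \<in> X" for x y
    proof (rule le_mult_graph_dist[OF _ s])
      show "step_graph X m r \<subseteq> X \<times> X" by (auto simp: step_graph_def)
      show "?s (id u) (id v) \<le> of_nat 1" if "(u, v) \<in> step_graph X m r" for u v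
      proof -
        have uv: "u \<in> X" "v \<in> X" "m u v \<le> of_nat r" using that by (auto simp: step_graph_def)
        have "d u v \<le> of_nat n" using R[OF uv] by (simp add: n_def add_increasing)
        then have "?s u v \<le> 1" using uv by (intro step_dist_le_1)
        then show ?thesis by simp
      qed
    qed (use that in auto)
    then have "prec X ?s (step_dist X m r)" by (intro prec_if_le_mult[of _ _ 1]) auto
    then have "prec X ?s m" using r prec_trans by blast
    moreover have "?s \<in> quasigeodesic_above TYPE('a + 'v) X d"
      unfolding quasigeodesic_above_def
      using s quasigeodesic_graph_dist simple_graph_step_graph[OF d] prec_step_dist[OF d] by blast
    ultimately have "prec X m ?s" using min by (auto simp: prec_minimal_def)
    then obtain N :: nat where N: "\<And>x y. x \<in> X \<Longrightarrow> y \<in> X \<Longrightarrow> ?s x y \<le> of_nat 1 \<Longrightarrow> m x y \<le> of_nat N"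
      using prec_imp_controlled unfolding controlled_iff by (metis id_apply)
    have "m x y \<le> of_nat N" if "x \<in> X" "y \<in> X" "d x y \<le> of_nat k" for x y
      using N step_dist_le_1[of x X y d n] that by (simp add: n_def add_increasing2)
    then show ?thesis by blast
  qed
  then have "controlled X d X m id" by (simp add: controlled_iff)
  then show ?thesis using coarsely_geodesic_if_controlled m by blast
qed

theorem theorem1p8:
  fixes X :: "'a set" and d :: "'a \<Rightarrow> 'a \<Rightarrow> ennreal"
  assumes "ext_metric X d"
  shows "(coarsely_geodesic TYPE('a + 'v) X d \<longleftrightarrow> (\<exists>m. prec_maximal X (coarse_class X d) m))
    \<and> (coarsely_geodesic TYPE('a + 'v) X d \<longleftrightarrow>
         (\<exists>m. prec_minimal X (quasigeodesic_above TYPE('a + 'v) X d) m))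
    \<and> ((\<exists>m. prec_maximal X (coarse_class X d) m) \<or>
       (\<exists>m. prec_minimal X (quasigeodesic_above TYPE('a + 'v) X d) m) \<longrightarrow>
         (\<forall>d'. ext_metric X d' \<and> quasigeodesic TYPE('a + 'v) X d' \<and>
               coarsely_equivalent_metrics X d d' \<longrightarrow>
           prec_maximal X (coarse_class X d) d' \<and>
           prec_minimal X (quasigeodesic_above TYPE('a + 'v) X d) d'))"
proof -
  let ?T = "TYPE('a + 'v)"
  have ext: "prec_maximal X (coarse_class X d) d' \<and> prec_minimal X (quasigeodesic_above ?T X d) d'"
    if "ext_metric X d'" "quasigeodesic ?T X d'" "coarsely_equivalent_metrics X d d'" for d'
    using quasigeodesic_extremal[OF assms _ that(2)] that by (simp add: coarse_class_def)
  have "\<exists>m. prec_maximal X (coarse_class X d) m \<and> prec_minimal X (quasigeodesic_above ?T X d) m"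
    if geod: "coarsely_geodesic ?T X d"
  proof -
    obtain n where n: "controlled X d X (step_dist X d n) id"
      using coarsely_geodesic_imp_controlled_step_dist[OF assms geod] .
    \<comment> \<open>This one graph distance witnesses both extremal properties at once.\<close>
    have "step_dist X d n \<in> coarse_class X d"
      unfolding mem_coarse_class_iff[OF assms]
      using n ext_metric_step_dist[OF assms] prec_imp_controlled[OF prec_step_dist[OF assms]] by blast
    then show ?thesis
      using quasigeodesic_extremal[OF assms]
        quasigeodesic_graph_dist[OF simple_graph_step_graph[OF assms]] by blast
  qed
  then show ?thesis
    using ext coarsely_geodesic_if_maximal[OF assms] coarsely_geodesic_if_minimal[OF assms] by blast
qed

end
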